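(* Let $\beta>0$. For any segment $s$, with disutilities sorted in ascending order $V_{s0}\le V_{s1}\le\dots\le V_{sW}$, let the sequence $(c_{sw})_{w\in\{1,\dots,W\}}$ be $$c_{sw}:=\frac1w\Big[\frac2\beta+\sum_{w'=0}^{w-1}V_{sw'}\Big],$$ and let the index $\tau$ be defined as $\tau=\min\{w\in\{1,\dots,W\}: V_{sw}\ge c_{sw}\}$. Then $$V_{sw}<c_{s\tau}\ \text{ for } w<\tau,\qquad V_{sw}\ge c_{s\tau}\ \text{ for } w\ge\tau.$$ Moreover, the solution $(y_s,\lambda_s,\mu_s)$ of the KKT system $$V_{sw}+\tfrac2\beta y_{sw}-\lambda_{sw}-\mu_s=0,\quad 0\le y_{sw}\perp\lambda_{sw}\ge0\quad(w\in\{0,\dots,W\}),\qquad y_s\in\Delta_{W+1},\ \lambda_s\in\mathbb{R}_{\ge0}^{W+1},\ \mu_s\in\mathbb{R}$$ can be expressed as follows: (i) $y_{sw}=\frac\beta2[c_{s\tau}-V_{sw}]$ for $w<\tau$, and $y_{sw}=0$ for $w\ge\tau$; (ii) $\lambda_{sw}=0$ for $w<\tau$; $\lambda_{s\tau}=V_{s\tau}-c_{s\tau}$; $\lambda_{sw}=\lambda_{s,w-1}+V_{sw}-V_{s,w-1}$ for $w>\tau$; (iii) $\mu_s=c_{s\tau}$. The index $\tau$ is therefore the index from which the probability $y$ becomes zero.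
   Context: $\Delta_{W+1}=\{y\in\mathbb{R}_{\ge0}^{W+1}:\sum_{w=0}^W y_w=1\}$, with coordinates indexed by $0,\dots,W$. The notation $0\le a\perp b\ge0$ means $a\ge0$, $b\ge0$ and $ab=0$. The real numbers $V_{s0},\dots,V_{sW}$ are the disutilities of customer segment $s$ for the contracts $w=0,\dots,W$; the KKT system is that of the problem $\min_{y\in\Delta_{W+1}}\sum_{w=0}^W(V_{sw}y_w+\frac1\beta y_w^2)$.
   Formalization: It is assumed that some w in {1,…,W} satisfies V_sw ≥ c_sw; without this the index τ is the minimum of an empty set and is undefined (for example W=1, V_s0=V_s1=0, β=1, where c_s1=2). *)

theory Defs
  imports Complex_Main
begin

text \<open>A vector of \<open>\<real>\<^sup>W\<^sup>+\<^sup>1\<close> with coordinates \<open>0, \<dots>, W\<close> is a function on \<open>nat\<close>, of which only the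
  values at arguments \<open>\<le> W\<close> are ever used.\<close>

definition nonneg_orthant :: "nat \<Rightarrow> (nat \<Rightarrow> real) set" where
  "nonneg_orthant W = {y. \<forall>w\<in>{0..W}. 0 \<le> y w}"

definition prob_simplex :: "nat \<Rightarrow> (nat \<Rightarrow> real) set" where
  "prob_simplex W = {y \<in> nonneg_orthant W. (\<Sum>w=0..W. y w) = 1}"

definition compl :: "real \<Rightarrow> real \<Rightarrow> bool" where
  "compl a b \<longleftrightarrow> 0 \<le> a \<and> 0 \<le> b \<and> a * b = 0"

definition kkt_system ::
  "nat \<Rightarrow> real \<Rightarrow> (nat \<Rightarrow> real) \<Rightarrow> (nat \<Rightarrow> real) \<Rightarrow> (nat \<Rightarrow> real) \<Rightarrow> real \<Rightarrow> bool" where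
  "kkt_system W \<beta> v y l m \<longleftrightarrow>
     (\<forall>w\<in>{0..W}. v w + 2 / \<beta> * y w - l w - m = 0 \<and> compl (y w) (l w)) \<and>
     y \<in> prob_simplex W \<and> l \<in> nonneg_orthant W"

text \<open>Meaningful for \<open>w \<ge> 1\<close> only.\<close>

definition c :: "real \<Rightarrow> ('s \<Rightarrow> nat \<Rightarrow> real) \<Rightarrow> 's \<Rightarrow> nat \<Rightarrow> real" where
  "c \<beta> V s w = 1 / real w * (2 / \<beta> + (\<Sum>w'<w. V s w'))"

end

theory Submission
  imports Defs
begin

text \<open>Complementarity forces \<open>y\<^sub>w = \<beta>/2 max(0, \<mu> - V\<^sub>w)\<close> and
  \<open>\<lambda>\<^sub>w = max(0, V\<^sub>w - \<mu>)\<close>, so the KKT system reduces to the water-filling equation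
  \<open>\<Sum>\<^sub>w max(0, \<mu> - V\<^sub>w) = 2/\<beta>\<close> for \<open>\<mu>\<close>. Its left-hand side increases strictly where it is
  positive, so the solution is unique; it is \<open>c\<^sub>\<tau>\<close> because exactly the terms with \<open>w < \<tau>\<close> are
  positive at \<open>\<mu> = c\<^sub>\<tau>\<close>.\<close>

text \<open>Complementary numbers have disjoint support, so a difference \<open>x\<close> of two of
  them determines both: they are its positive and its negative part.\<close>

lemma compl_diff_iff:
  "compl a b \<and> a - b = x \<longleftrightarrow> a = max 0 x \<and> b = max 0 (- x)"
  by (auto simp: compl_def max_def)

text \<open>Scaling \<open>y\<close> by the positive factor \<open>2 / \<beta>\<close> preserves
  complementarity, and stationarity then fixes the difference of the complementary pair as
  \<open>m - v\<close>.\<close>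

lemma stationary_compl_iff:
  fixes \<beta> v y l m :: real
  assumes "\<beta> > 0"
  shows "v + 2 / \<beta> * y - l - m = 0 \<and> compl y l \<longleftrightarrow>
    y = \<beta> / 2 * max 0 (m - v) \<and> l = max 0 (v - m)"
proof -
  have "compl y l \<longleftrightarrow> compl (2 / \<beta> * y) l"
    using assms by (auto simp: compl_def zero_le_divide_iff)
  moreover have "2 / \<beta> * y = x \<longleftrightarrow> y = \<beta> / 2 * x" for x
    using assms by (auto simp: field_simps)
  moreover have "v + 2 / \<beta> * y - l - m = 0 \<longleftrightarrow> 2 / \<beta> * y - l = m - v"
    by linarith
  ultimately show ?thesis
    using compl_diff_iff[of "2 / \<beta> * y" l "m - v"] by auto
qed

lemma kkt_system_iff_water_filling:
  assumes "\<beta> > 0"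
  shows "kkt_system W \<beta> v y l m \<longleftrightarrow>
    (\<forall>w\<in>{0..W}. y w = \<beta> / 2 * max 0 (m - v w) \<and> l w = max 0 (v w - m)) \<and>
    (\<Sum>w=0..W. max 0 (m - v w)) = 2 / \<beta>"
proof -
  have "(\<Sum>w=0..W. y w) = 1 \<longleftrightarrow> (\<Sum>w=0..W. max 0 (m - v w)) = 2 / \<beta>"
    if "\<forall>w\<in>{0..W}. y w = \<beta> / 2 * max 0 (m - v w)"
  proof -
    have "(\<Sum>w=0..W. y w) = \<beta> / 2 * (\<Sum>w=0..W. max 0 (m - v w))"
      using that unfolding sum_distrib_left by (intro sum.cong) auto
    then show ?thesis
      using assms by (auto simp: field_simps)
  qed
  moreover have "0 \<le> \<beta> / 2 * max 0 (m - v w)" for w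
    using assms by simp
  ultimately show ?thesis
    unfolding kkt_system_def stationary_compl_iff[OF assms] prob_simplex_def nonneg_orthant_def
    by (auto simp del: times_divide_eq_left times_divide_eq_right)
qed

text \<open>Each summand is weakly increasing in the level. The one at \<open>a\<close> grows
  strictly because it is positive at the upper level \<open>n\<close>.\<close>

lemma sum_max_diff_strict_mono:
  fixes v :: "'a \<Rightarrow> real"
  assumes "finite A" "a \<in> A" "v a < n" "m < n"
  shows "(\<Sum>w\<in>A. max 0 (m - v w)) < (\<Sum>w\<in>A. max 0 (n - v w))"
  using assms by (intro sum_strict_mono_ex1) (auto intro!: bexI[of _ a])

text \<open>It is enough that one of the levels exceeds some \<open>v a\<close>: either
  \<open>n\<close> is the larger level, or \<open>m\<close> is and then exceeds \<open>v a\<close>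
  as well.\<close>

lemma sum_max_diff_inj:
  fixes v :: "'a \<Rightarrow> real"
  assumes "finite A" "a \<in> A" "v a < n"
    and "(\<Sum>w\<in>A. max 0 (m - v w)) = (\<Sum>w\<in>A. max 0 (n - v w))"
  shows "m = n"
  using sum_max_diff_strict_mono[of A a v n m] sum_max_diff_strict_mono[of A a v m n] assms
  by (cases m n rule: linorder_cases) auto

text \<open>Telescoping: this links the closed form of the multiplier, which complementarity yields,
  to the recursive form in the theorem.\<close>

lemma eq_diff_const_iff_recursion:
  fixes l v :: "nat \<Rightarrow> real"
  assumes "t \<le> W"
  shows "(\<forall>w\<in>{t..W}. l w = v w - k) \<longleftrightarrow>
    l t = v t - k \<and> (\<forall>w\<in>{t<..W}. l w = l (w - 1) + v w - v (w - 1))"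
    (is "?L \<longleftrightarrow> ?R")
proof
  assume L: ?L
  have "l w = l (w - 1) + v w - v (w - 1)" if "t < w" "w \<le> W" for w
  proof -
    have "w \<in> {t..W}" "w - 1 \<in> {t..W}" using that by auto
    then show ?thesis using L by simp
  qed
  then show ?R
    using L assms by simp
next
  assume R: ?R
  have "l w = v w - k" if "t \<le> w" "w \<le> W" for w
    using that
  proof (induction w rule: dec_induct)
    case base
    then show ?case using R by blast
  next
    case (step w)
    then show ?case using bspec[OF conjunct2[OF R], of "Suc w"] by simp
  qed
  then show ?L by simp
qed

lemma c_times_index:
  assumes "t > 0"
  shows "real t * c \<beta> V s t = 2 / \<beta> + (\<Sum>w<t. V s w)"
  using assms by (simp add: c_def)

text \<open>With \<open>t = Suc n\<close> and \<open>n > 0\<close>, \<open>c\<close> at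
  \<open>t\<close> is a weighted average of \<open>c\<close> at \<open>n\<close> and
  \<open>V s n\<close>, so it stays above \<open>V s n\<close> whenever \<open>c\<close> at
  \<open>n\<close> does. Monotonicity carries the bound to all earlier indices.\<close>

lemma less_c_before_first_crossing:
  assumes "\<beta> > 0" "t > 0" "mono_on {..<t} (V s)"
    and below: "\<And>w. 0 < w \<Longrightarrow> w < t \<Longrightarrow> V s w < c \<beta> V s w"
    and "w < t"
  shows "V s w < c \<beta> V s t"
proof -
  obtain n where t: "t = Suc n"
    using \<open>t > 0\<close> gr0_implies_Suc by blast
  \<comment> \<open>Stated without division in order to include \<open>n = 0\<close>, where
    \<open>c\<close> has no meaning and the claim is just \<open>0 < 2 / \<beta>\<close>.\<close>
  have "real n * V s n < 2 / \<beta> + (\<Sum>w<n. V s w)"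
  proof (cases "n = 0")
    case True
    then show ?thesis using \<open>\<beta> > 0\<close> by simp
  next
    case False
    then have "real n * V s n < real n * c \<beta> V s n"
      using below[of n] t by simp
    then show ?thesis using c_times_index[of n \<beta> V s] False by simp
  qed
  \<comment> \<open>Add \<open>V s n\<close> to both sides.\<close>
  then have "real t * V s n < real t * c \<beta> V s t"
    using c_times_index[OF \<open>t > 0\<close>, of \<beta> V s] t by (simp add: algebra_simps)
  then have "V s n < c \<beta> V s t"
    using \<open>t > 0\<close> by simp
  moreover have "V s w \<le> V s n"
    using assms(3,5) t by (auto intro: mono_onD)
  ultimately show ?thesis by simp
qed

theorem proposition3p3:
  fixes \<beta> :: real and W :: nat and V :: "'s \<Rightarrow> nat \<Rightarrow> real" and s :: 's and \<tau> :: nat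
  assumes "\<beta> > 0"
    and "mono_on {0..W} (V s)"
    and "{w \<in> {1..W}. V s w \<ge> c \<beta> V s w} \<noteq> {}"
    and "\<tau> = Min {w \<in> {1..W}. V s w \<ge> c \<beta> V s w}"
  shows "(\<forall>w<\<tau>. V s w < c \<beta> V s \<tau>) \<and> (\<forall>w\<in>{\<tau>..W}. V s w \<ge> c \<beta> V s \<tau>) \<and>
    (\<exists>y l m. kkt_system W \<beta> (V s) y l m) \<and>
    (\<forall>y l m. kkt_system W \<beta> (V s) y l m \<longleftrightarrow>
        (\<forall>w<\<tau>. y w = \<beta> / 2 * (c \<beta> V s \<tau> - V s w)) \<and> (\<forall>w\<in>{\<tau>..W}. y w = 0) \<and>
        (\<forall>w<\<tau>. l w = 0) \<and> l \<tau> = V s \<tau> - c \<beta> V s \<tau> \<and>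
        (\<forall>w\<in>{\<tau><..W}. l w = l (w - 1) + V s w - V s (w - 1)) \<and>
        m = c \<beta> V s \<tau>) \<and>
    (\<forall>y l m. kkt_system W \<beta> (V s) y l m \<longrightarrow>
        (\<forall>w<\<tau>. y w > 0) \<and> (\<forall>w\<in>{\<tau>..W}. y w = 0))"
proof -
  let ?S = "{w \<in> {1..W}. V s w \<ge> c \<beta> V s w}" and ?v = "V s" and ?k = "c \<beta> V s \<tau>"
  have "\<tau> \<in> ?S"
    using assms(3,4) Min_in[of ?S] by simp
  then have \<tau>: "0 < \<tau>" "\<tau> \<le> W" "?v \<tau> \<ge> ?k" by auto
  have "?v w < c \<beta> V s w" if "0 < w" "w < \<tau>" for w
  proof (rule ccontr)
    assume "\<not> ?v w < c \<beta> V s w"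
    then have "\<tau> \<le> w"
      using that \<tau> assms(4) by auto
    then show False using that by simp
  qed
  moreover have "mono_on {..<\<tau>} ?v"
    using \<tau> by (intro mono_on_subset[OF assms(2)]) auto
  ultimately have lt: "?v w < ?k" if "w < \<tau>" for w
    using less_c_before_first_crossing[of \<beta> \<tau> V s w] assms(1) \<tau>(1) that by blast
  have ge: "?k \<le> ?v w" if "\<tau> \<le> w" "w \<le> W" for w
    using mono_onD[OF assms(2), of \<tau> w] \<tau>(3) that by simp

  \<comment> \<open>The level \<open>?k\<close> solves the water-filling equation: the terms from
    \<open>\<tau>\<close> on vanish, and for the others the definition of \<open>c\<close> gives the
    total.\<close>
  have "(\<Sum>w=0..W. max 0 (?k - ?v w)) = (\<Sum>w<\<tau>. max 0 (?k - ?v w))"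
    using \<tau>(2) ge by (intro sum.mono_neutral_right) auto
  also have "\<dots> = (\<Sum>w<\<tau>. ?k - ?v w)"
    using lt by (intro sum.cong) (auto simp: less_imp_le)
  also have "\<dots> = 2 / \<beta>"
    using c_times_index[OF \<tau>(1), of \<beta> V s] by (simp add: sum_subtractf)
  finally have fill: "(\<Sum>w=0..W. max 0 (?k - ?v w)) = 2 / \<beta>" .

  \<comment> \<open>Uniqueness of the level applies with index \<open>0\<close> as witness, since
    \<open>0 < \<tau>\<close> puts \<open>?v 0\<close> strictly below \<open>?k\<close>.\<close>
  have kkt: "kkt_system W \<beta> ?v y l m \<longleftrightarrow>
      (\<forall>w\<in>{0..W}. y w = \<beta> / 2 * max 0 (?k - ?v w) \<and> l w = max 0 (?v w - ?k)) \<and> m = ?k"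
    for y l m
    unfolding kkt_system_iff_water_filling[OF assms(1)]
    using sum_max_diff_inj[of "{0..W}" 0 ?v ?k m] lt[OF \<tau>(1)] fill by auto
  have split: "(\<forall>w\<in>{0..W}. P w) \<longleftrightarrow> (\<forall>w<\<tau>. P w) \<and> (\<forall>w\<in>{\<tau>..W}. P w)" for P
    using \<tau>(2) by (auto simp: not_less)
  have sol: "kkt_system W \<beta> ?v y l m \<longleftrightarrow>
      (\<forall>w<\<tau>. y w = \<beta> / 2 * (?k - ?v w)) \<and> (\<forall>w\<in>{\<tau>..W}. y w = 0) \<and>
      (\<forall>w<\<tau>. l w = 0) \<and> (\<forall>w\<in>{\<tau>..W}. l w = ?v w - ?k) \<and> m = ?k" for y l m
  proof -
    have "max 0 (?k - ?v w) = ?k - ?v w" "max 0 (?v w - ?k) = 0" if "w < \<tau>" for w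
      using lt[OF that] by simp_all
    moreover have "max 0 (?k - ?v w) = 0" "max 0 (?v w - ?k) = ?v w - ?k" if "w \<in> {\<tau>..W}" for w
      using ge[of w] that by simp_all
    ultimately show ?thesis
      unfolding kkt split by auto
  qed
  have "kkt_system W \<beta> ?v (\<lambda>w. \<beta> / 2 * max 0 (?k - ?v w)) (\<lambda>w. max 0 (?v w - ?k)) ?k"
    unfolding kkt by simp
  then have "\<exists>y l m. kkt_system W \<beta> ?v y l m"
    by blast
  \<comment> \<open>Positivity before \<open>\<tau>\<close> is the strict inequality
    \<open>lt\<close>, scaled by \<open>\<beta> / 2\<close>.\<close>
  moreover have "\<forall>y l m. kkt_system W \<beta> ?v y l m \<longrightarrow> (\<forall>w<\<tau>. y w > 0) \<and> (\<forall>w\<in>{\<tau>..W}. y w = 0)"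
    unfolding sol using lt assms(1)
    by (auto simp del: times_divide_eq_left times_divide_eq_right)
  moreover have "\<forall>y l m. kkt_system W \<beta> ?v y l m \<longleftrightarrow>
      (\<forall>w<\<tau>. y w = \<beta> / 2 * (?k - ?v w)) \<and> (\<forall>w\<in>{\<tau>..W}. y w = 0) \<and>
      (\<forall>w<\<tau>. l w = 0) \<and> l \<tau> = ?v \<tau> - ?k \<and>
      (\<forall>w\<in>{\<tau><..W}. l w = l (w - 1) + ?v w - ?v (w - 1)) \<and> m = ?k"
    unfolding sol eq_diff_const_iff_recursion[OF \<tau>(2)] conj_assoc by (intro allI refl)
  moreover have "(\<forall>w<\<tau>. ?v w < ?k) \<and> (\<forall>w\<in>{\<tau>..W}. ?v w \<ge> ?k)"
    using lt ge by simp
  ultimately show ?thesis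
    by (intro conjI) (elim conjE, assumption)+
qed

end
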